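(* Let $\Omega\subseteq\mathbb{R}^n$ and $f:\Omega\to\mathbb{R}^n$, and let $G\subseteq\Omega$ be forward invariant, where for each $x\in G$ the solution $\phi_f(x,t)$ of $\dot x=f(x)$ starting at $x$ exists uniquely for all $t\ge 0$ and depends continuously on the initial condition. Let $p,k>0$ and $M\geq 1$. If there exists a continuous function $V:G\to\mathbb{R}_+$ such that, for all $x\in G$, $$M^{-1}\|x\|_2^p\leq V(x)\leq\|x\|_2^p,\qquad \dot V(x)\leq-kV(x)^2,$$ then $f$ is rationally stable on $G$ with power $p$, rate $k$, and gain $M$.
   Context: $\mathbb{R}_+:=[0,\infty)$. For a vector field $f:\Omega\to\mathbb{R}^n$ on $\Omega\subseteq\mathbb{R}^n$, $\phi_f(x,t)$ denotes the solution at time $t$ of the ODE initialized at $x$: $\frac{\partial}{\partial t}\phi_f(x,t)=f(\phi_f(x,t))$, $\phi_f(x,0)=x$. Standing assumption: the solutions under consideration exist uniquely for all $t\in\mathbb{R}_+$ and depend continuously on their initial conditions; by uniqueness, $\phi_f(\phi_f(x,t),s)=\phi_f(x,t+s)$ for $t,s\geq 0$. A set $G\subseteq\Omega$ is forward invariant if $x\in G$ implies $\phi_f(x,t)\in G$ for all $t\geq0$. For continuous $V$, $\dot V(x):=\limsup_{\Delta t\to0^+}\frac{V(\phi_f(x,\Delta t))-V(x)}{\Delta t}$ (upper right-hand Dini derivative along solutions). For $p,k>0$ and $M\geq 1$, $f$ is rationally stable on $G$ with power $p$, rate $k$, and gain $M$ if $\|\phi_f(x,t)\|_2^p\leq M\frac{\|x\|_2^p}{1+\|x\|_2^p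 kt}$ for all $x\in G$ and $t\geq0$. *)

theory Defs
  imports "HOL-Analysis.Analysis"
begin

text \<open>
  A vector field on \<open>\<Omega>\<close> is a total function of which only the values on \<open>\<Omega>\<close> are used: solutions are
  required to stay in \<open>\<Omega>\<close>. Solutions live on the half-line, so the derivative at time \<open>0\<close> is the
  right derivative.
\<close>

definition is_solution ::
  "(real ^ 'n) set \<Rightarrow> (real ^ 'n \<Rightarrow> real ^ 'n) \<Rightarrow> real ^ 'n \<Rightarrow> (real \<Rightarrow> real ^ 'n) \<Rightarrow> bool" where
  "is_solution \<Omega> f x g \<longleftrightarrow>
     g 0 = x \<and>
     (\<forall>t\<ge>0. g t \<in> \<Omega> \<and> (g has_vector_derivative f (g t)) (at t within {0..}))"

text \<open>Uniqueness concerns times \<open>t \<ge> 0\<close> only; values at negative times are junk.\<close>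

definition unique_solution ::
  "(real ^ 'n) set \<Rightarrow> (real ^ 'n \<Rightarrow> real ^ 'n) \<Rightarrow> real ^ 'n \<Rightarrow> bool" where
  "unique_solution \<Omega> f x \<longleftrightarrow>
     (\<exists>g. is_solution \<Omega> f x g) \<and>
     (\<forall>g h. is_solution \<Omega> f x g \<longrightarrow> is_solution \<Omega> f x h \<longrightarrow> (\<forall>t\<ge>0. g t = h t))"

text \<open>
  The solution map \<open>\<phi>\<^sub>f\<close>. It is meaningful for \<open>t \<ge> 0\<close> and initial values \<open>x\<close> with
  \<open>unique_solution \<Omega> f x\<close>; then the description picks the common value at time \<open>t\<close> of all solutions.
\<close>

definition flow ::
  "(real ^ 'n) set \<Rightarrow> (real ^ 'n \<Rightarrow> real ^ 'n) \<Rightarrow> real ^ 'n \<Rightarrow> real \<Rightarrow> real ^ 'n" where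
  "flow \<Omega> f x t = (THE y. \<exists>g. is_solution \<Omega> f x g \<and> g t = y)"

definition well_posed_on ::
  "(real ^ 'n) set \<Rightarrow> (real ^ 'n \<Rightarrow> real ^ 'n) \<Rightarrow> (real ^ 'n) set \<Rightarrow> bool" where
  "well_posed_on \<Omega> f G \<longleftrightarrow>
     (\<forall>x\<in>G. unique_solution \<Omega> f x) \<and>
     (\<forall>t\<ge>0. continuous_on G (\<lambda>x. flow \<Omega> f x t))"

definition forward_invariant ::
  "(real ^ 'n) set \<Rightarrow> (real ^ 'n \<Rightarrow> real ^ 'n) \<Rightarrow> (real ^ 'n) set \<Rightarrow> bool" where
  "forward_invariant \<Omega> f G \<longleftrightarrow> (\<forall>x\<in>G. \<forall>t\<ge>0. flow \<Omega> f x t \<in> G)"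

text \<open>Extended-real valued, since the limit superior may be infinite.\<close>

definition upper_dini ::
  "(real ^ 'n) set \<Rightarrow> (real ^ 'n \<Rightarrow> real ^ 'n) \<Rightarrow> (real ^ 'n \<Rightarrow> real) \<Rightarrow> real ^ 'n \<Rightarrow> ereal" where
  "upper_dini \<Omega> f V x =
     Limsup (at_right 0) (\<lambda>d. ereal ((V (flow \<Omega> f x d) - V x) / d))"

definition rationally_stable ::
  "(real ^ 'n) set \<Rightarrow> (real ^ 'n \<Rightarrow> real ^ 'n) \<Rightarrow> (real ^ 'n) set \<Rightarrow> real \<Rightarrow> real \<Rightarrow> real \<Rightarrow> bool" where
  "rationally_stable \<Omega> f G p k M \<longleftrightarrow>
     p > 0 \<and> k > 0 \<and> M \<ge> 1 \<and>
     (\<forall>x\<in>G. \<forall>t\<ge>0.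
        norm (flow \<Omega> f x t) powr p
          \<le> M * (norm x powr p / (1 + norm x powr p * k * t)))"

end

theory Submission
  imports Defs
begin

text \<open>
  Along a solution starting at \<open>x\<close>, the value \<open>v\<close> of \<open>V\<close> starts below \<open>c = \<parallel>x\<parallel>\<^sup>p + e\<close> and has upper
  right Dini derivative at most \<open>- k v\<^sup>2\<close>. The curve \<open>y(t) = c / (1 + k' c t)\<close> solves
  \<open>y' = - k' y\<^sup>2\<close>. For \<open>0 < k' < k\<close> and \<open>e > 0\<close> it is positive, so \<open>v\<close> descends strictly faster than
  \<open>y\<close> wherever the two meet and can never cross it upwards. Letting \<open>e \<rightarrow> 0\<close> and \<open>k' \<rightarrow> k\<close> bounds
  \<open>v(t)\<close> by \<open>\<parallel>x\<parallel>\<^sup>p / (1 + \<parallel>x\<parallel>\<^sup>p k t)\<close>, and \<open>\<parallel>\<phi>\<^sub>f(x,t)\<parallel>\<^sup>p \<le> M v(t)\<close>.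
\<close>

text \<open>If \<open>u b\<close> exceeded \<open>y b\<close>, take the last time \<tau> at which
  \<open>u\<close> is not above \<open>y\<close>. Continuity from the right forces equality there,
  and \<open>touch\<close> then keeps \<open>u\<close> below \<open>y\<close> a little longer,
  contradicting the choice of \<tau>.\<close>

lemma no_upcrossing_le:
  fixes u y :: "real \<Rightarrow> real"
  assumes "a \<le> b"
    and cont: "continuous_on {a..b} u" "continuous_on {a..b} y"
    and "u a \<le> y a"
    and touch: "\<And>t. a \<le> t \<Longrightarrow> t < b \<Longrightarrow> u t = y t \<Longrightarrow> eventually (\<lambda>s. u s \<le> y s) (at_right t)"
  shows "u b \<le> y b"
proof (rule ccontr)
  assume "\<not> u b \<le> y b"
  define S where "S = {t \<in> {a..b}. u t \<le> y t}"
  define \<tau> where "\<tau> = Sup S"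
  have "closed S"
    unfolding S_def using cont by (intro continuous_on_closed_Collect_le) auto
  moreover have "a \<in> S"
    using assms by (simp add: S_def)
  moreover have "bdd_above S"
    by (auto simp: S_def)
  ultimately have S: "closed S" "S \<noteq> {}" "bdd_above S"
    by auto
  then have "\<tau> \<in> S"
    unfolding \<tau>_def by (intro closed_contains_Sup)
  then have \<tau>: "a \<le> \<tau>" "\<tau> < b" "u \<tau> \<le> y \<tau>"
    using \<open>\<not> u b \<le> y b\<close> by (auto simp: S_def less_le)
  have "y s < u s" if "\<tau> < s" "s < b" for s
  proof (rule ccontr)
    assume "\<not> y s < u s"
    with that \<tau> have "s \<in> S"
      by (simp add: S_def)
    then have "s \<le> \<tau>"
      unfolding \<tau>_def using S by (intro cSup_upper)
    with that show False by simp
  qed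
  then have above: "eventually (\<lambda>s. y s < u s) (at_right \<tau>)"
    using \<tau> by (auto simp: eventually_at_right)
  \<comment> \<open>Only the one-sided limit is available, since \<tau> may be the left endpoint
    \<open>a\<close>.\<close>
  have right_lim: "(h \<longlongrightarrow> h \<tau>) (at_right \<tau>)" if "continuous_on {a..b} h" for h :: "real \<Rightarrow> real"
  proof -
    have "continuous (at \<tau> within {a..b}) h"
      using that \<tau> by (auto simp: continuous_on_eq_continuous_within)
    then have "(h \<longlongrightarrow> h \<tau>) (at \<tau> within {\<tau>..b})"
      unfolding continuous_within by (rule tendsto_within_subset) (use \<tau> in auto)
    then show ?thesis
      using \<tau> by (simp add: at_within_Icc_at_right)
  qed
  have "y \<tau> \<le> u \<tau>"
    using right_lim[OF cont(1)] right_lim[OF cont(2)] eventually_mono[OF above]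
    by (intro tendsto_le[where F = "at_right \<tau>" and f = u and g = y]) auto
  with \<tau> have "eventually (\<lambda>s. u s \<le> y s) (at_right \<tau>)"
    by (intro touch) auto
  with above have "eventually (\<lambda>s. False) (at_right \<tau>)"
    by eventually_elim simp
  then show False
    by simp
qed

lemma eventually_le_if_dini_less:
  fixes u y :: "real \<Rightarrow> real"
  assumes "Limsup (at_right 0) (\<lambda>d. ereal ((u (t + d) - u t) / d)) < ereal D"
    and "(y has_real_derivative D) (at t)"
    and "u t = y t"
  shows "eventually (\<lambda>s. u s \<le> y s) (at_right t)"
proof -
  \<comment> \<open>A Limsup bounds the quotients eventually only by constants strictly above it, so
    a real \<open>m\<close> is put in the gap to separate the quotients of \<open>u\<close> from
    those of \<open>y\<close>.\<close>
  obtain m where m: "Limsup (at_right 0) (\<lambda>d. ereal ((u (t + d) - u t) / d)) < ereal m" "m < D"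
    using ereal_dense2[OF assms(1)] by auto
  have "((\<lambda>d. (y (t + d) - y t) / d) \<longlongrightarrow> D) (at_right 0)"
    using assms(2) unfolding DERIV_def by (rule filterlim_mono) (auto simp: at_le)
  then have "eventually (\<lambda>d. m < (y (t + d) - y t) / d) (at_right 0)"
    using m by (simp add: order_tendstoD)
  moreover have "eventually (\<lambda>d. ereal ((u (t + d) - u t) / d) < ereal m) (at_right 0)"
    using m(1) by (rule Limsup_lessD)
  moreover have "eventually (\<lambda>d::real. 0 < d) (at_right 0)"
    by (rule eventually_at_right_less)
  ultimately have "eventually (\<lambda>d. u (t + d) \<le> y (t + d)) (at_right 0)"
  proof eventually_elim
    case (elim d)
    then have "(u (t + d) - u t) / d < (y (t + d) - y t) / d"
      by simp
    with elim assms(3) show ?case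
      by (simp add: divide_less_cancel)
  qed
  then show ?thesis
    by (subst eventually_at_right_to_0) (simp add: add.commute)
qed

text \<open>Starting from any upper bound \<open>X\<close> of \<open>v 0\<close> avoids a separate
  monotonicity argument for the bound in \<open>X\<close>.\<close>

lemma riccati_dini_bound:
  fixes v :: "real \<Rightarrow> real"
  assumes "0 \<le> T" "0 < k" "0 \<le> X" "v 0 \<le> X"
    and cont: "continuous_on {0..T} v"
    and dini: "\<And>t. 0 \<le> t \<Longrightarrow> t < T \<Longrightarrow>
      Limsup (at_right 0) (\<lambda>d. ereal ((v (t + d) - v t) / d)) \<le> ereal (- k * (v t)\<^sup>2)"
  shows "v T \<le> X / (1 + X * k * T)"
proof -
  \<comment> \<open>Lowering the rate makes the comparison of slopes strict only where
    \<open>y\<close> is nonzero; raising the start value ensures this even for \<open>X = 0\<close>.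
    One \<open>e\<close> serves both, so a single limit removes it.\<close>
  have perturbed: "v T \<le> (X + e) / (1 + (X + e) * (k - e) * T)" if "0 < e" "e < k" for e
  proof -
    define c k' where "c = X + e" and "k' = k - e"
    define y where "y = (\<lambda>t. c / (1 + c * k' * t))"
    have ck: "0 < c" "0 < k'" "k' < k"
      using that assms by (auto simp: c_def k'_def)
    have den: "0 < 1 + c * k' * t" if "0 \<le> t" for t
      using that ck by (simp add: add_pos_nonneg)
    have deriv: "(y has_real_derivative - k' * (y t)\<^sup>2) (at t)" if "0 \<le> t" for t
      unfolding y_def using den[OF that]
      by (auto intro!: derivative_eq_intros simp: field_simps power2_eq_square)
    have "v T \<le> y T"
    proof (rule no_upcrossing_le[OF \<open>0 \<le> T\<close> cont])
      show "continuous_on {0..T} y"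
        using deriv by (intro continuous_at_imp_continuous_on ballI) (auto intro: DERIV_isCont)
      show "v 0 \<le> y 0"
        using assms that by (simp add: y_def c_def)
    next
      fix t assume t: "0 \<le> t" "t < T" "v t = y t"
      have "0 < y t"
        using den[OF t(1)] ck by (simp add: y_def)
      with ck have "- k * (v t)\<^sup>2 < - k' * (y t)\<^sup>2"
        by (simp add: t)
      then have "Limsup (at_right 0) (\<lambda>d. ereal ((v (t + d) - v t) / d)) < ereal (- k' * (y t)\<^sup>2)"
        using dini[OF t(1,2)] by (meson le_less_trans less_ereal.simps(1))
      then show "eventually (\<lambda>s. v s \<le> y s) (at_right t)"
        using deriv[OF t(1)] t(3) by (rule eventually_le_if_dini_less)
    qed
    then show ?thesis
      by (simp add: y_def c_def k'_def)
  qed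
  have "1 + X * k * T \<noteq> 0"
    using assms by (smt (verit) mult_nonneg_nonneg)
  then have "((\<lambda>e. (X + e) / (1 + (X + e) * (k - e) * T)) \<longlongrightarrow>
      (X + 0) / (1 + (X + 0) * (k - 0) * T)) (at_right 0)"
    by (intro tendsto_intros) auto
  moreover have "eventually (\<lambda>e. v T \<le> (X + e) / (1 + (X + e) * (k - e) * T)) (at_right 0)"
    using perturbed \<open>0 < k\<close> by (auto simp: eventually_at_right)
  ultimately show ?thesis
    using tendsto_lowerbound[of _ _ "at_right (0::real)"] by fastforce
qed

lemma flow_eq:
  assumes "unique_solution \<Omega> f x" "is_solution \<Omega> f x g" "0 \<le> t"
  shows "flow \<Omega> f x t = g t"
  unfolding flow_def using assms by (intro the_equality) (auto simp: unique_solution_def)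

text \<open>Holds because \<open>f\<close> does not depend on time. It identifies the flow restarted
  at \<open>g t\<close> with the continuation of \<open>g\<close>.\<close>

lemma is_solution_shift:
  assumes "is_solution \<Omega> f x g" "0 \<le> t"
  shows "is_solution \<Omega> f (g t) (\<lambda>s. g (t + s))"
  unfolding is_solution_def
proof (intro conjI allI impI)
  fix s :: real assume "0 \<le> s"
  with assms show "g (t + s) \<in> \<Omega>"
    by (simp add: is_solution_def)
  have "(g has_vector_derivative f (g (t + s))) (at (t + s) within {0..})"
    using assms \<open>0 \<le> s\<close> by (simp add: is_solution_def)
  \<comment> \<open>The shifted half-line is \<open>{t..}\<close>, a subset of \<open>{0..}\<close>;
    at \<open>s = 0\<close> this leaves just the right derivative of \<open>g\<close> at
    \<open>t\<close>.\<close>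
  then have "(g has_vector_derivative f (g (t + s))) (at (t + s) within (+) t ` {0..})"
    by (rule has_vector_derivative_within_subset) (use assms in auto)
  then have "((g \<circ> (+) t) has_vector_derivative 1 *\<^sub>R f (g (t + s))) (at s within {0..})"
    by (intro vector_diff_chain_within) (auto intro!: derivative_eq_intros)
  then show "((\<lambda>s. g (t + s)) has_vector_derivative f (g (t + s))) (at s within {0..})"
    by (simp add: o_def)
qed simp

theorem theorem5:
  fixes \<Omega> G :: "(real ^ 'n) set"
    and f :: "real ^ 'n \<Rightarrow> real ^ 'n"
    and p k M :: real
  assumes "G \<subseteq> \<Omega>"
    and "well_posed_on \<Omega> f G"
    and "forward_invariant \<Omega> f G"
    and "p > 0" and "k > 0" and "M \<ge> 1"
    and "\<exists>V :: real ^ 'n \<Rightarrow> real.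
           continuous_on G V \<and>
           (\<forall>x\<in>G. V x \<ge> 0 \<and>
                  inverse M * norm x powr p \<le> V x \<and> V x \<le> norm x powr p \<and>
                  upper_dini \<Omega> f V x \<le> ereal (- k * (V x)\<^sup>2))"
  shows "rationally_stable \<Omega> f G p k M"
  unfolding rationally_stable_def
proof (intro conjI ballI allI impI)
  fix x T assume x: "x \<in> G" and T: "(0::real) \<le> T"
  obtain V :: "real ^ 'n \<Rightarrow> real" where contV: "continuous_on G V"
    and lower: "\<And>z. z \<in> G \<Longrightarrow> inverse M * norm z powr p \<le> V z"
    and upper: "\<And>z. z \<in> G \<Longrightarrow> V z \<le> norm z powr p"
    and dini: "\<And>z. z \<in> G \<Longrightarrow> upper_dini \<Omega> f V z \<le> ereal (- k * (V z)\<^sup>2)"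
    using assms(7) by blast
  have unique: "unique_solution \<Omega> f z" if "z \<in> G" for z
    using assms(2) that by (simp add: well_posed_on_def)
  obtain g where g: "is_solution \<Omega> f x g"
    using unique[OF x] by (auto simp: unique_solution_def)
  have flow_g: "flow \<Omega> f x t = g t" if "0 \<le> t" for t
    using flow_eq[OF unique[OF x] g that] .
  have g_in: "g t \<in> G" if "0 \<le> t" for t
    using assms(3) x that flow_g by (force simp: forward_invariant_def)
  have g0: "g 0 = x"
    using g by (simp add: is_solution_def)
  have "V (g T) \<le> norm x powr p / (1 + norm x powr p * k * T)"
  proof (rule riccati_dini_bound[where v = "\<lambda>t. V (g t)"])
    have "continuous_on {0..} g"
      using g by (auto simp: is_solution_def continuous_on_eq_continuous_within
          intro: has_vector_derivative_continuous)
    then have "continuous_on {0..T} g"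
      by (rule continuous_on_subset) auto
    then show "continuous_on {0..T} (\<lambda>t. V (g t))"
      by (rule continuous_on_compose2[OF contV]) (use g_in in auto)
  next
    fix t :: real assume t: "0 \<le> t"
    \<comment> \<open>\<open>upper_dini\<close> at \<open>g t\<close> follows the flow restarted
      there. Agreement for \<open>d\<close> \<ge> 0 suffices, as the Limsup is taken from the
      right.\<close>
    have "flow \<Omega> f (g t) d = g (t + d)" if "0 \<le> d" for d
      using flow_eq[OF unique[OF g_in[OF t]] is_solution_shift[OF g t] that] .
    then have "eventually (\<lambda>d. ereal ((V (g (t + d)) - V (g t)) / d) =
        ereal ((V (flow \<Omega> f (g t) d) - V (g t)) / d)) (at_right 0)"
      by (intro eventually_mono[OF eventually_at_right_less[of "0::real"]]) simp
    then have "Limsup (at_right 0) (\<lambda>d. ereal ((V (g (t + d)) - V (g t)) / d)) =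
        upper_dini \<Omega> f V (g t)"
      unfolding upper_dini_def by (rule Limsup_eq)
    then show "Limsup (at_right 0) (\<lambda>d. ereal ((V (g (t + d)) - V (g t)) / d))
        \<le> ereal (- k * (V (g t))\<^sup>2)"
      using dini[OF g_in[OF t]] by simp
  qed (use T x upper g0 \<open>k > 0\<close> in auto)
  \<comment> \<open>The gain comes from the lower bound on \<open>V\<close> at time
    \<open>T\<close>; the upper bound on \<open>V\<close> served only at time 0.\<close>
  moreover have "norm (g T) powr p \<le> M * V (g T)"
    using lower[OF g_in[OF T]] \<open>M \<ge> 1\<close> by (simp add: field_simps)
  ultimately show "norm (flow \<Omega> f x T) powr p \<le> M * (norm x powr p / (1 + norm x powr p * k * T))"
    using \<open>M \<ge> 1\<close> flow_g[OF T]
    by (metis mult_left_mono order.trans zero_le_one)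
qed (use assms in auto)

end
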